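(* Let $p$ be an odd prime and let $G$ be a noncyclic finite nilpotent group of class at most two and exponent $p$. Write $G=K\oplus C_p^r$, where $C_p$ is cyclic of order $p$, $r\ge 0$, and $K$ satisfies $Z(K)=[K,K]$. Then $G$ is capable if and only if $K$ is capable.
   Context: A group $G$ is capable if there is a group $H$ with $G\cong H/Z(H)$. "Class two" means class at most two. $\oplus$ denotes the direct product of groups, and $C_p^r$ is the direct product of $r$ copies of $C_p$. *)

theory Defs
  imports "HOL-Algebra.Algebra" "HOL-Computational_Algebra.Primes"
begin

definition group_center :: "('a, 'b) monoid_scheme \<Rightarrow> 'a set" where
  "group_center G = {z \<in> carrier G. \<forall>x\<in>carrier G. z \<otimes>\<^bsub>G\<^esub> x = x \<otimes>\<^bsub>G\<^esub> z}"

text \<open>The subgroup \<open>[A, B]\<close>, with the commutator convention of the library, so that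
  \<open>commutator_subgroup G A A = derived G A\<close>.\<close>

definition commutator_subgroup :: "('a, 'b) monoid_scheme \<Rightarrow> 'a set \<Rightarrow> 'a set \<Rightarrow> 'a set" where
  "commutator_subgroup G A B =
     generate G (\<Union>a\<in>A. \<Union>b\<in>B. {a \<otimes>\<^bsub>G\<^esub> b \<otimes>\<^bsub>G\<^esub> inv\<^bsub>G\<^esub> a \<otimes>\<^bsub>G\<^esub> inv\<^bsub>G\<^esub> b})"

text \<open>Indexed from 0: \<open>lower_central_series G n\<close> is usually written \<open>\<gamma>\<^sub>n\<^sub>+\<^sub>1(G)\<close>.\<close>

primrec lower_central_series :: "('a, 'b) monoid_scheme \<Rightarrow> nat \<Rightarrow> 'a set" where
  "lower_central_series G 0 = carrier G"
| "lower_central_series G (Suc n) =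
     commutator_subgroup G (lower_central_series G n) (carrier G)"

definition nilpotent_class_le :: "('a, 'b) monoid_scheme \<Rightarrow> nat \<Rightarrow> bool" where
  "nilpotent_class_le G c \<longleftrightarrow> lower_central_series G c = {\<one>\<^bsub>G\<^esub>}"

text \<open>Unspecified if no positive exponent exists; for a finite group one always does.\<close>

definition group_exponent :: "('a, 'b) monoid_scheme \<Rightarrow> nat" where
  "group_exponent G = (LEAST n. 0 < n \<and> (\<forall>x\<in>carrier G. x [^]\<^bsub>G\<^esub> n = \<one>\<^bsub>G\<^esub>))"

definition cyclic_power :: "nat \<Rightarrow> nat \<Rightarrow> (nat \<Rightarrow> int) monoid" where
  "cyclic_power p r = product_group {..<r} (\<lambda>_. integer_mod_group p)"

text \<open>\<open>G\<close> is capable if \<open>G \<cong> H / Z(H)\<close> for some group \<open>H\<close>. The elements of a witness \<open>H\<close> have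
  to be drawn from a fixed type; we use words in letters \<open>a\<close> and \<open>a\<^sup>-\<^sup>1\<close> with
  \<open>a :: 'a\<close>. This is no restriction: a witness over any other type can be replaced by one
  over words, as lemma \<open>capableI\<close> below shows, because the subgroup of \<open>H\<close> generated by lifts
  of the elements of \<open>G\<close> is again a witness.\<close>

definition capable :: "('a, 'b) monoid_scheme \<Rightarrow> bool" where
  "capable G \<longleftrightarrow>
     (\<exists>H :: (bool \<times> 'a) list monoid. group H \<and> G \<cong> H Mod group_center H)"

lemma group_center_normal:
  assumes "group H"
  shows "group_center H \<lhd> H"
proof -
  interpret group H by fact
  have "subgroup (group_center H) H"
  proof (rule subgroupI)
    fix a assume a: "a \<in> group_center H"
    then have ac: "a \<in> carrier H" and com: "\<And>x. x \<in> carrier H \<Longrightarrow> a \<otimes>\<^bsub>H\<^esub> x = x \<otimes>\<^bsub>H\<^esub> a"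
      unfolding group_center_def by blast+
    have "inv\<^bsub>H\<^esub> a \<otimes>\<^bsub>H\<^esub> x = x \<otimes>\<^bsub>H\<^esub> inv\<^bsub>H\<^esub> a" if x: "x \<in> carrier H" for x
    proof -
      have "inv\<^bsub>H\<^esub> (inv\<^bsub>H\<^esub> x \<otimes>\<^bsub>H\<^esub> a) = inv\<^bsub>H\<^esub> (a \<otimes>\<^bsub>H\<^esub> inv\<^bsub>H\<^esub> x)"
        by (rule arg_cong[OF com[OF inv_closed[OF x], symmetric]])
      then show ?thesis using ac x by (simp add: inv_mult_group)
    qed
    then show "inv\<^bsub>H\<^esub> a \<in> group_center H"
      using ac unfolding group_center_def by blast
    fix b assume b: "b \<in> group_center H"
    then have bc: "b \<in> carrier H" and comb: "\<And>x. x \<in> carrier H \<Longrightarrow> b \<otimes>\<^bsub>H\<^esub> x = x \<otimes>\<^bsub>H\<^esub> b"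
      unfolding group_center_def by blast+
    have "a \<otimes>\<^bsub>H\<^esub> b \<otimes>\<^bsub>H\<^esub> x = x \<otimes>\<^bsub>H\<^esub> (a \<otimes>\<^bsub>H\<^esub> b)" if x: "x \<in> carrier H" for x
    proof -
      have "a \<otimes>\<^bsub>H\<^esub> b \<otimes>\<^bsub>H\<^esub> x = a \<otimes>\<^bsub>H\<^esub> (x \<otimes>\<^bsub>H\<^esub> b)" by (simp only: m_assoc[OF ac bc x] comb[OF x])
      also have "\<dots> = x \<otimes>\<^bsub>H\<^esub> a \<otimes>\<^bsub>H\<^esub> b" by (simp only: m_assoc[OF ac x bc, symmetric] com[OF x])
      finally show ?thesis by (simp only: m_assoc[OF x ac bc])
    qed
    then show "a \<otimes>\<^bsub>H\<^esub> b \<in> group_center H"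
      using ac bc unfolding group_center_def by blast
  qed (auto simp: group_center_def)
  then show ?thesis
    by (rule normalI) (auto simp: group_center_def r_coset_def l_coset_def)
qed

lemma generate_words:
  fixes H :: "('h, 'c) monoid_scheme" and t :: "'a \<Rightarrow> 'h"
  assumes "group H" "\<And>a. a \<in> A \<Longrightarrow> t a \<in> carrier H"
  shows "\<exists>f :: 'h \<Rightarrow> (bool \<times> 'a) list. inj_on f (generate H (t ` A))"
proof -
  interpret group H by fact
  define ev where "ev = (\<lambda>w. foldr (\<lambda>(b, a) y. (if b then t a else inv\<^bsub>H\<^esub> (t a)) \<otimes>\<^bsub>H\<^esub> y) w \<one>\<^bsub>H\<^esub>)"
  define W where "W = {w :: (bool \<times> 'a) list. snd ` set w \<subseteq> A}"
  have cl: "ev w \<in> carrier H" if "w \<in> W" for w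
    using that unfolding W_def ev_def by (induction w) (auto simp: assms)
  have app: "ev (v @ w) = ev v \<otimes>\<^bsub>H\<^esub> ev w" if "v \<in> W" "w \<in> W" for v w
    using that(1)
  proof (induction v)
    case Nil
    then show ?case using cl[OF that(2)] by (simp add: ev_def)
  next
    case (Cons x v)
    obtain b a where x: "x = (b, a)" by force
    have v: "v \<in> W" and a: "t a \<in> carrier H" using Cons.prems assms by (auto simp: W_def x)
    show ?case using Cons.IH[OF v] cl[OF v] cl[OF that(2)] a
      by (simp add: ev_def x m_assoc)
  qed
  have sub: "x \<in> ev ` W" if "x \<in> generate H (t ` A)" for x
    using that
  proof induction
    case one
    show ?case by (rule image_eqI[of _ _ "[]"]) (auto simp: ev_def W_def)
  next
    case (incl h)
    then obtain a where "a \<in> A" "h = t a" by blast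
    then show ?case
      by (intro image_eqI[of _ _ "[(True, a)]"]) (auto simp: ev_def W_def assms)
  next
    case (inv h)
    then obtain a where "a \<in> A" "h = t a" by blast
    then show ?case
      by (intro image_eqI[of _ _ "[(False, a)]"]) (auto simp: ev_def W_def assms)
  next
    case (eng h1 h2)
    then obtain v w where *: "v \<in> W" "w \<in> W" "h1 = ev v" "h2 = ev w" by blast
    then show ?case
      by (intro image_eqI[of _ _ "v @ w"]) (auto simp: app, auto simp: W_def)
  qed
  then show ?thesis
    by (meson inj_on_inv_into inj_on_subset subsetI)
qed

lemma capableI:
  fixes G :: "('a, 'b) monoid_scheme" and H :: "('h, 'c) monoid_scheme"
  assumes "group G" "group H" "G \<cong> H Mod group_center H"
  shows "capable G"
proof -
  interpret H: group H by fact
  define Z where "Z = group_center H"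
  interpret Z: normal Z H unfolding Z_def by (rule group_center_normal) fact
  obtain \<phi> where \<phi>: "\<phi> \<in> iso G (H Mod Z)"
    using assms(3) unfolding is_iso_def Z_def by blast
  have im: "\<phi> ` carrier G = (\<lambda>x. Z #>\<^bsub>H\<^esub> x) ` carrier H"
    using \<phi> by (simp add: iso_def bij_betw_def carrier_FactGroup)
  then have "\<forall>a\<in>carrier G. \<exists>x. x \<in> carrier H \<and> \<phi> a = Z #>\<^bsub>H\<^esub> x"
    by blast
  then obtain t where t: "\<And>a. a \<in> carrier G \<Longrightarrow> t a \<in> carrier H \<and> \<phi> a = Z #>\<^bsub>H\<^esub> t a"
    by metis
  define S where "S = generate H (t ` carrier G)"
  have S: "subgroup S H"
    unfolding S_def by (rule H.generate_is_subgroup) (use t in auto)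
  then interpret S: subgroup S H .
  obtain f :: "'h \<Rightarrow> (bool \<times> 'a) list" where f: "inj_on f S"
    using generate_words[OF \<open>group H\<close>, of "carrier G" t] t unfolding S_def by blast
  define HS where "HS = H\<lparr>carrier := S\<rparr>"
  have HS: "group HS" unfolding HS_def by (rule H.subgroup_imp_group[OF S])
  have fHS: "inj_on f (carrier HS)" using f by (simp add: HS_def)
  define L where "L = image_group f HS"
  have L: "group L" unfolding L_def by (rule group.inj_imp_image_group_is_group[OF HS fHS])
  define g where "g = inv_into S f"
  have g: "g \<in> iso L HS"
  proof (rule isoI)
    show "g \<in> hom L HS"
      using f by (auto intro!: homI simp: L_def g_def HS_def image_group_def)
    show "bij_betw g (carrier L) (carrier HS)"
      using f by (simp add: L_def g_def HS_def image_group_def inj_on_imp_bij_betw bij_betw_inv_into)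
  qed
  have gcl: "g x \<in> S" if "x \<in> carrier L" for x
    using g that by (auto simp: iso_def hom_def HS_def)
  have gim: "g ` carrier L = S"
    using g by (simp add: iso_def bij_betw_def HS_def)
  have ginj: "inj_on g (carrier L)"
    using g by (simp add: iso_def bij_betw_def)
  have gm: "g (x \<otimes>\<^bsub>L\<^esub> y) = g x \<otimes>\<^bsub>H\<^esub> g y" if "x \<in> carrier L" "y \<in> carrier L" for x y
    using g that by (auto simp: iso_def hom_def HS_def)
  define \<psi> where "\<psi> = (\<lambda>x. Z #>\<^bsub>H\<^esub> g x)"
  have Hom: "group_hom L (H Mod Z) \<psi>"
  proof (intro group_hom.intro group_hom_axioms.intro L Z.factorgroup_is_group homI)
    show "\<psi> x \<in> carrier (H Mod Z)" if "x \<in> carrier L" for x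
      using gcl[OF that] S.subset by (auto simp: \<psi>_def carrier_FactGroup)
    show "\<psi> (x \<otimes>\<^bsub>L\<^esub> y) = \<psi> x \<otimes>\<^bsub>H Mod Z\<^esub> \<psi> y" if "x \<in> carrier L" "y \<in> carrier L" for x y
      using gcl[OF that(1)] gcl[OF that(2)] S.subset
      by (auto simp: \<psi>_def gm[OF that] Z.rcos_sum)
  qed
  have cover: "\<exists>s\<in>S. Z #>\<^bsub>H\<^esub> x = Z #>\<^bsub>H\<^esub> s" if x: "x \<in> carrier H" for x
  proof -
    obtain a where "a \<in> carrier G" "Z #>\<^bsub>H\<^esub> x = \<phi> a" using im x by (metis imageE imageI)
    then show ?thesis using t[of a] unfolding S_def by (metis generate.incl imageI)
  qed
  have onto: "\<psi> ` carrier L = carrier (H Mod Z)"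
  proof -
    have "\<psi> ` carrier L = (\<lambda>x. Z #>\<^bsub>H\<^esub> x) ` S"
      unfolding \<psi>_def gim[symmetric] by (simp add: image_image)
    also have "\<dots> = (\<lambda>x. Z #>\<^bsub>H\<^esub> x) ` carrier H"
      using cover S.subset by (auto simp: image_iff)
    finally show ?thesis by (simp add: carrier_FactGroup)
  qed
  have cen: "s \<in> Z" if s: "s \<in> S" and com: "\<forall>u\<in>S. s \<otimes>\<^bsub>H\<^esub> u = u \<otimes>\<^bsub>H\<^esub> s" for s
  proof -
    have "s \<otimes>\<^bsub>H\<^esub> x = x \<otimes>\<^bsub>H\<^esub> s" if x: "x \<in> carrier H" for x
    proof -
      obtain u where u: "u \<in> S" "Z #>\<^bsub>H\<^esub> x = Z #>\<^bsub>H\<^esub> u" using cover[OF x] by blast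
      then have "x \<in> Z #>\<^bsub>H\<^esub> u" using H.rcos_self[OF x Z.subgroup_axioms] by simp
      then obtain z where z: "z \<in> Z" "x = z \<otimes>\<^bsub>H\<^esub> u" by (auto simp: r_coset_def)
      have c: "s \<in> carrier H" "u \<in> carrier H" "z \<in> carrier H"
        using s u z S.subset Z.subset by auto
      have sz: "z \<otimes>\<^bsub>H\<^esub> s = s \<otimes>\<^bsub>H\<^esub> z" using z(1) c(1) unfolding Z_def group_center_def by blast
      have su: "s \<otimes>\<^bsub>H\<^esub> u = u \<otimes>\<^bsub>H\<^esub> s" using com u(1) by blast
      have "s \<otimes>\<^bsub>H\<^esub> (z \<otimes>\<^bsub>H\<^esub> u) = z \<otimes>\<^bsub>H\<^esub> (s \<otimes>\<^bsub>H\<^esub> u)"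
        using c by (simp only: H.m_assoc[symmetric] sz[symmetric])
      also have "\<dots> = z \<otimes>\<^bsub>H\<^esub> u \<otimes>\<^bsub>H\<^esub> s"
        using c by (simp only: H.m_assoc su)
      finally show ?thesis by (simp only: z(2))
    qed
    then show ?thesis using s S.subset unfolding Z_def group_center_def by blast
  qed
  have ker: "kernel L (H Mod Z) \<psi> = group_center L"
  proof -
    have "\<psi> x = Z \<longleftrightarrow> (\<forall>y\<in>carrier L. x \<otimes>\<^bsub>L\<^esub> y = y \<otimes>\<^bsub>L\<^esub> x)" if x: "x \<in> carrier L" for x
    proof -
      have gx: "g x \<in> carrier H" using gcl[OF x] S.subset by auto
      have "\<psi> x = Z \<longleftrightarrow> g x \<in> Z"
        unfolding \<psi>_def using H.coset_join1[OF _ gx Z.subgroup_axioms]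
          H.coset_join2[OF gx Z.subgroup_axioms] by blast
      also have "\<dots> \<longleftrightarrow> (\<forall>u\<in>S. g x \<otimes>\<^bsub>H\<^esub> u = u \<otimes>\<^bsub>H\<^esub> g x)"
      proof
        assume "g x \<in> Z"
        then show "\<forall>u\<in>S. g x \<otimes>\<^bsub>H\<^esub> u = u \<otimes>\<^bsub>H\<^esub> g x"
          using S.subset unfolding Z_def group_center_def by blast
      qed (rule cen[OF gcl[OF x]])
      also have "\<dots> \<longleftrightarrow> (\<forall>y\<in>carrier L. g (x \<otimes>\<^bsub>L\<^esub> y) = g (y \<otimes>\<^bsub>L\<^esub> x))"
        unfolding gim[symmetric] using gm x by simp
      also have "\<dots> \<longleftrightarrow> (\<forall>y\<in>carrier L. x \<otimes>\<^bsub>L\<^esub> y = y \<otimes>\<^bsub>L\<^esub> x)"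
      proof (rule ball_cong[OF refl])
        fix y assume y: "y \<in> carrier L"
        interpret L: group L by (rule L)
        show "g (x \<otimes>\<^bsub>L\<^esub> y) = g (y \<otimes>\<^bsub>L\<^esub> x) \<longleftrightarrow> x \<otimes>\<^bsub>L\<^esub> y = y \<otimes>\<^bsub>L\<^esub> x"
          by (rule inj_on_eq_iff[OF ginj L.m_closed[OF x y] L.m_closed[OF y x]])
      qed
      finally show ?thesis .
    qed
    then show ?thesis unfolding kernel_def group_center_def one_FactGroup by blast
  qed
  have "L Mod group_center L \<cong> H Mod Z"
    using group_hom.FactGroup_iso[OF Hom onto] by (simp add: ker)
  then have "H Mod Z \<cong> L Mod group_center L"
    by (rule group.iso_sym[OF normal.factorgroup_is_group[OF group_center_normal[OF L]]])
  then have "G \<cong> L Mod group_center L"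
    using assms(3) unfolding Z_def[symmetric] by (rule iso_trans[rotated])
  with L show ?thesis unfolding capable_def by blast
qed

end

theory Submission
  imports Defs
begin

text \<open>Write \<open>V = C\<^sub>p\<^sup>r\<close>, so that \<open>G \<cong> K \<times> V\<close>. Throughout, a witness for the capability of a
  group \<open>Q\<close> is handled as an epimorphism \<open>H \<rightarrow> Q\<close> whose kernel is \<open>Z(H)\<close>.

  If \<open>K \<times> V\<close> is capable, take such an \<open>H\<close> and let \<open>M\<close> and \<open>N\<close> be the preimages of \<open>K\<close> and \<open>V\<close>. Then
  \<open>H = MN\<close>, and \<open>[M, N] \<le> Z(H)\<close> because \<open>K\<close> and \<open>V\<close> commute. For fixed \<open>n \<in> N\<close> the map
  \<open>m \<mapsto> [m, n]\<close> is therefore a homomorphism from \<open>M\<close> to an abelian group, and it kills \<open>[M, M]\<close>.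
  An element of \<open>Z(M)\<close> maps into \<open>Z(K) = [K, K]\<close>, hence lies in \<open>[M, M] Z(H)\<close>, hence commutes with
  \<open>N\<close> as well as with \<open>M\<close>. So \<open>Z(M) = Z(H)\<close>, and \<open>K \<cong> M / Z(M)\<close> is capable. This is
  \<open>capable_direct_factor\<close>.

  Conversely, let \<open>f\<close> be a homomorphism from a group \<open>H\<close> onto \<open>C\<^sub>p\<close>, and let \<open>h \<in> H\<close> act on
  \<open>V \<times> V\<close> by the shear \<open>(v, t) \<mapsto> (v, t v\<^bsup>f(h)\<^esup>)\<close>. In the resulting semidirect product, an element with
  coordinates \<open>(h, v, t)\<close> is central exactly when \<open>h\<close> is central in \<open>H\<close> and acts trivially and \<open>v = 1\<close>.
  Its central quotient is therefore the product of \<open>V\<close> with the quotient of \<open>H\<close> by the central elements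
  that act trivially (\<open>capable_times_if_kernel\<close>). If \<open>K\<close> is capable and
  nontrivial, start from its witness \<open>H\<close>: since \<open>Z(K) = [K, K]\<close>, the group \<open>K\<close> is not perfect,
  so it maps onto \<open>C\<^sub>p\<close>, and \<open>Z(H)\<close> acts trivially because the action factors through \<open>K\<close>
  (\<open>capable_times_if_hom_onto\<close>). If \<open>K\<close> is trivial, then \<open>r \<ge> 2\<close> because \<open>G\<close> is not cyclic; the same
  construction with \<open>H = C\<^sub>p\<close> and \<open>C\<^sub>p\<^bsup>r-1\<^esup>\<close> for \<open>V\<close>, where only \<open>0\<close> acts trivially, shows that
  \<open>C\<^sub>p\<^sup>r\<close> is capable (\<open>capable_cyclic_power\<close>).\<close>

section \<open>Capability through central epimorphisms\<close>

lemma capable_if_epi: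
  assumes "group H" "group K" "\<pi> \<in> hom H K" "\<pi> ` carrier H = carrier K"
    and "kernel H K \<pi> = group_center H"
  shows "capable K"
proof -
  interpret group_hom H K \<pi>
    using assms by (simp add: group_hom_def group_hom_axioms_def)
  have "H Mod group_center H \<cong> K"
    using FactGroup_iso[OF assms(4)] by (simp add: assms(5))
  then have "K \<cong> H Mod group_center H"
    by (rule group.iso_sym[OF normal.factorgroup_is_group[OF group_center_normal[OF assms(1)]]])
  then show ?thesis
    by (rule capableI[OF assms(2,1)])
qed

lemma capable_epiE:
  fixes K :: "('a, 'b) monoid_scheme"
  assumes "capable K" "group K"
  obtains H :: "(bool \<times> 'a) list monoid" and \<pi>
  where "group H" "\<pi> \<in> hom H K" "\<pi> ` carrier H = carrier K" "kernel H K \<pi> = group_center H"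
proof -
  obtain H :: "(bool \<times> 'a) list monoid" where H: "group H" and iso: "K \<cong> H Mod group_center H"
    using assms(1) unfolding capable_def by blast
  interpret H: group H by (rule H)
  interpret Z: normal "group_center H" H by (rule group_center_normal[OF H])
  obtain \<psi> where \<psi>: "\<psi> \<in> iso (H Mod group_center H) K"
    using group.iso_sym[OF assms(2) iso] unfolding is_iso_def by blast
  interpret \<psi>: group_hom "H Mod group_center H" K \<psi>
    using \<psi> assms(2) Z.factorgroup_is_group by (simp add: group_hom_def group_hom_axioms_def iso_def)
  define \<pi> where "\<pi> = \<psi> \<circ> (\<lambda>h. group_center H #>\<^bsub>H\<^esub> h)"
  have "\<pi> \<in> hom H K"
    unfolding \<pi>_def by (rule hom_compose[OF Z.r_coset_hom_Mod \<psi>.homh])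
  moreover have "\<pi> ` carrier H = carrier K"
    using \<psi> unfolding \<pi>_def image_comp[symmetric]
    by (simp add: iso_def bij_betw_def carrier_FactGroup)
  moreover have "kernel H K \<pi> = group_center H"
  proof -
    have inj: "inj_on \<psi> (carrier (H Mod group_center H))"
      using \<psi> by (simp add: iso_def bij_betw_def)
    have "\<pi> h = \<one>\<^bsub>K\<^esub> \<longleftrightarrow> h \<in> group_center H" if h: "h \<in> carrier H" for h
    proof -
      have c: "group_center H #>\<^bsub>H\<^esub> h \<in> carrier (H Mod group_center H)"
        using h by (auto simp: carrier_FactGroup)
      have "\<pi> h = \<one>\<^bsub>K\<^esub> \<longleftrightarrow> \<psi> (group_center H #>\<^bsub>H\<^esub> h) = \<psi> \<one>\<^bsub>H Mod group_center H\<^esub>"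
        by (simp only: \<pi>_def comp_apply \<psi>.hom_one)
      also have "\<dots> \<longleftrightarrow> group_center H #>\<^bsub>H\<^esub> h = group_center H"
        using inj_on_eq_iff[OF inj c \<psi>.G.one_closed] by (simp add: one_FactGroup)
      also have "\<dots> \<longleftrightarrow> h \<in> group_center H"
        using H.coset_join1[OF _ h Z.subgroup_axioms] H.coset_join2[OF h Z.subgroup_axioms] by blast
      finally show ?thesis .
    qed
    then show ?thesis
      using Z.subset unfolding kernel_def by blast
  qed
  ultimately show thesis using that H by blast
qed

lemma capable_iso:
  assumes "capable G" "group G" "group G'" "G \<cong> G'"
  shows "capable G'"
proof -
  obtain H :: "(bool \<times> 'a) list monoid" where H: "group H" "G \<cong> H Mod group_center H"
    using assms(1) unfolding capable_def by blast
  show ?thesis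
    by (rule capableI[OF assms(3) H(1) iso_trans[OF group.iso_sym[OF assms(2,4)] H(2)]])
qed

section \<open>Passing to a direct factor\<close>

lemma (in group) cancel_inv_left:
  assumes "x \<in> carrier G" "y \<in> carrier G"
  shows "inv x \<otimes> (x \<otimes> y) = y" "x \<otimes> (inv x \<otimes> y) = y"
  using assms by (simp_all add: m_assoc[symmetric])

lemma (in group_hom) derived_le_kernel:
  assumes "comm_group H"
  shows "derived G (carrier G) \<subseteq> kernel G H h"
  unfolding derived_def
proof (rule G.generate_subgroup_incl[OF _ subgroup_kernel])
  interpret H: comm_group H by (rule assms)
  have "h (a \<otimes>\<^bsub>G\<^esub> b \<otimes>\<^bsub>G\<^esub> inv\<^bsub>G\<^esub> a \<otimes>\<^bsub>G\<^esub> inv\<^bsub>G\<^esub> b) = \<one>\<^bsub>H\<^esub>" if "a \<in> carrier G" "b \<in> carrier G" for a b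
  proof -
    have ab: "h a \<in> carrier H" "h b \<in> carrier H" using that by auto
    have "h (a \<otimes>\<^bsub>G\<^esub> b \<otimes>\<^bsub>G\<^esub> inv\<^bsub>G\<^esub> a \<otimes>\<^bsub>G\<^esub> inv\<^bsub>G\<^esub> b)
        = (h b \<otimes>\<^bsub>H\<^esub> h a) \<otimes>\<^bsub>H\<^esub> inv\<^bsub>H\<^esub> h a \<otimes>\<^bsub>H\<^esub> inv\<^bsub>H\<^esub> h b"
      unfolding H.m_comm[OF ab(2,1)] using that by simp
    also have "\<dots> = \<one>\<^bsub>H\<^esub>" using ab by (simp add: H.m_assoc H.cancel_inv_left)
    finally show ?thesis .
  qed
  then show "derived_set G (carrier G) \<subseteq> kernel G H h"
    by (auto simp: kernel_def)
qed

text \<open>The preimage \<open>M\<close> of \<open>K\<close> in a witness \<open>H\<close> for \<open>K \<times> V\<close> is a witness for \<open>K\<close>. The condition on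
  \<open>Z(K)\<close> keeps \<open>Z(M)\<close> from exceeding \<open>Z(H)\<close>; for instance \<open>C\<^sub>p \<times> C\<^sub>p\<close> is capable but \<open>C\<^sub>p\<close> is not.\<close>

lemma capable_direct_factor:
  fixes K :: "('k, 'c) monoid_scheme" and V :: "('v, 'd) monoid_scheme"
  assumes K: "group K" and V: "group V" and cap: "capable (K \<times>\<times> V)"
    and cen: "group_center K \<subseteq> derived K (carrier K)"
  shows "capable K"
proof -
  interpret K: group K by (rule K)
  interpret V: group V by (rule V)
  obtain H :: "(bool \<times> 'k \<times> 'v) list monoid" and \<pi>
    where H: "group H" and \<pi>: "\<pi> \<in> hom H (K \<times>\<times> V)"
    and onto: "\<pi> ` carrier H = carrier (K \<times>\<times> V)" and ker: "kernel H (K \<times>\<times> V) \<pi> = group_center H"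
    by (rule capable_epiE[OF cap DirProd_group[OF K V]])
  interpret H: group H by (rule H)
  define \<kappa> \<nu> where "\<kappa> = fst \<circ> \<pi>" and "\<nu> = snd \<circ> \<pi>"
  have "fst \<in> hom (K \<times>\<times> V) K" "snd \<in> hom (K \<times>\<times> V) V"
    by (auto simp: hom_def)
  then have \<kappa>: "\<kappa> \<in> hom H K" and \<nu>: "\<nu> \<in> hom H V"
    unfolding \<kappa>_def \<nu>_def by (simp_all only: hom_compose[OF \<pi>])
  interpret \<kappa>: group_hom H K \<kappa> using \<kappa> by (simp add: group_hom_def group_hom_axioms_def)
  interpret \<nu>: group_hom H V \<nu> using \<nu> by (simp add: group_hom_def group_hom_axioms_def)
  have Z: "z \<in> group_center H \<longleftrightarrow> z \<in> carrier H \<and> \<kappa> z = \<one>\<^bsub>K\<^esub> \<and> \<nu> z = \<one>\<^bsub>V\<^esub>" for z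
    unfolding ker[symmetric] kernel_def \<kappa>_def \<nu>_def by (auto simp: prod_eq_iff)
  have lift: "\<exists>h\<in>carrier H. \<kappa> h = k \<and> \<nu> h = v" if "k \<in> carrier K" "v \<in> carrier V" for k v
  proof -
    have "(k, v) \<in> \<pi> ` carrier H" using that onto by simp
    then obtain h where "h \<in> carrier H" "(k, v) = \<pi> h" by (rule imageE)
    then show ?thesis by (intro bexI[of _ h]) (simp_all add: \<kappa>_def \<nu>_def prod_eq_iff)
  qed
  define M where "M = kernel H V \<nu>"
  have M: "subgroup M H" unfolding M_def by (rule \<nu>.subgroup_kernel)
  have Msub: "M \<subseteq> carrier H" by (rule subgroup.subset[OF M])
  have M_iff: "x \<in> M \<longleftrightarrow> x \<in> carrier H \<and> \<nu> x = \<one>\<^bsub>V\<^esub>" for x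
    by (simp add: M_def kernel_def)
  define HM where "HM = H\<lparr>carrier := M\<rparr>"
  have HM: "group HM" unfolding HM_def by (rule H.subgroup_imp_group[OF M])
  have \<kappa>M: "group_hom HM K \<kappa>"
  proof (intro group_hom.intro group_hom_axioms.intro HM K homI)
    show "\<kappa> x \<in> carrier K" if "x \<in> carrier HM" for x
      using that by (simp add: HM_def M_iff)
    show "\<kappa> (x \<otimes>\<^bsub>HM\<^esub> y) = \<kappa> x \<otimes>\<^bsub>K\<^esub> \<kappa> y" if "x \<in> carrier HM" "y \<in> carrier HM" for x y
      using that by (simp add: HM_def M_iff)
  qed
  have ontoM: "\<kappa> ` carrier HM = carrier K"
  proof (intro equalityI subsetI)
    fix k assume k: "k \<in> carrier K"
    obtain h where h: "h \<in> carrier H" "\<kappa> h = k" "\<nu> h = \<one>\<^bsub>V\<^esub>"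
      using lift[OF k V.one_closed] by blast
    show "k \<in> \<kappa> ` carrier HM"
    proof (rule image_eqI)
      show "k = \<kappa> h" using h(2) by (rule sym)
      show "h \<in> carrier HM" using h by (simp add: HM_def M_iff)
    qed
  qed (use Msub in \<open>auto simp: HM_def\<close>)
  have kerM: "kernel HM K \<kappa> = group_center H"
    using Z by (auto simp: kernel_def HM_def M_iff)
  have central: "z \<otimes>\<^bsub>H\<^esub> x = x \<otimes>\<^bsub>H\<^esub> z" if "z \<in> group_center H" "x \<in> carrier H" for z x
    using that by (simp add: group_center_def)

  \<comment> \<open>The preimage of \<open>V\<close> centralises \<open>[M, M]\<close>: commutation with a fixed \<open>n\<close> is a homomorphism from
    \<open>M\<close> into the abelian group \<open>Z(H)\<close>.\<close>
  have N_commutes: "c \<otimes>\<^bsub>H\<^esub> n = n \<otimes>\<^bsub>H\<^esub> c"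
    if c: "c \<in> derived HM (carrier HM)" and n: "n \<in> carrier H" "\<kappa> n = \<one>\<^bsub>K\<^esub>" for c n
  proof -
    define \<chi> where "\<chi> m = m \<otimes>\<^bsub>H\<^esub> n \<otimes>\<^bsub>H\<^esub> inv\<^bsub>H\<^esub> m \<otimes>\<^bsub>H\<^esub> inv\<^bsub>H\<^esub> n" for m
    define ZH where "ZH = H\<lparr>carrier := group_center H\<rparr>"
    have subZ: "subgroup (group_center H) H"
      by (rule normal_imp_subgroup[OF group_center_normal[OF H]])
    have ZH: "comm_group ZH"
      unfolding ZH_def
    proof (rule group.group_comm_groupI[OF H.subgroup_imp_group[OF subZ]])
      fix x y
      assume "x \<in> carrier (H\<lparr>carrier := group_center H\<rparr>)" "y \<in> carrier (H\<lparr>carrier := group_center H\<rparr>)"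
      then show "x \<otimes>\<^bsub>H\<lparr>carrier := group_center H\<rparr>\<^esub> y = y \<otimes>\<^bsub>H\<lparr>carrier := group_center H\<rparr>\<^esub> x"
        using central[of x y] Z[of y] by simp
    qed
    have \<chi>Z: "\<chi> m \<in> group_center H" if "m \<in> M" for m
    proof -
      have "m \<in> carrier H" "\<nu> m = \<one>\<^bsub>V\<^esub>" using that by (auto simp: M_iff)
      then show ?thesis unfolding Z \<chi>_def using n by simp
    qed
    have \<chi>_mult: "\<chi> (a \<otimes>\<^bsub>H\<^esub> b) = \<chi> a \<otimes>\<^bsub>H\<^esub> \<chi> b" if ab: "a \<in> M" "b \<in> M" for a b
    proof -
      have abc: "a \<in> carrier H" "b \<in> carrier H" "\<chi> a \<in> carrier H" "\<chi> b \<in> carrier H"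
        using ab \<chi>Z[OF ab(1)] \<chi>Z[OF ab(2)] by (simp_all add: Z M_iff)
      have "\<chi> (a \<otimes>\<^bsub>H\<^esub> b) = a \<otimes>\<^bsub>H\<^esub> \<chi> b \<otimes>\<^bsub>H\<^esub> (n \<otimes>\<^bsub>H\<^esub> inv\<^bsub>H\<^esub> a \<otimes>\<^bsub>H\<^esub> inv\<^bsub>H\<^esub> n)"
        using abc n by (simp add: \<chi>_def H.inv_mult_group H.m_assoc H.cancel_inv_left)
      also have "\<dots> = \<chi> b \<otimes>\<^bsub>H\<^esub> \<chi> a"
        using abc n unfolding central[OF \<chi>Z[OF ab(2)] abc(1), symmetric]
        by (simp add: H.m_assoc) (simp add: \<chi>_def H.m_assoc)
      finally show ?thesis using central[OF \<chi>Z[OF ab(2)] abc(3)] by simp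
    qed
    have "group_hom HM ZH \<chi>"
      by (intro group_hom.intro group_hom_axioms.intro HM comm_group.axioms(2)[OF ZH] homI)
        (simp_all add: HM_def ZH_def \<chi>Z \<chi>_mult)
    from group_hom.derived_le_kernel[OF this ZH] c
    have "c \<in> carrier H" "\<chi> c = \<one>\<^bsub>H\<^esub>"
      using Msub by (auto simp: kernel_def HM_def ZH_def)
    moreover have "c \<otimes>\<^bsub>H\<^esub> n = \<chi> c \<otimes>\<^bsub>H\<^esub> (n \<otimes>\<^bsub>H\<^esub> c)" if "c \<in> carrier H"
      using that n by (simp add: \<chi>_def H.m_assoc H.cancel_inv_left)
    ultimately show ?thesis using n by simp
  qed

  have "group_center HM = group_center H"
  proof (intro equalityI subsetI)
    fix z assume "z \<in> group_center HM"
    then have zM: "z \<in> M" and comM: "\<And>m. m \<in> M \<Longrightarrow> z \<otimes>\<^bsub>H\<^esub> m = m \<otimes>\<^bsub>H\<^esub> z"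
      by (auto simp: group_center_def HM_def)
    have zc: "z \<in> carrier H" using zM Msub by blast
    have "\<kappa> z \<in> group_center K"
      unfolding group_center_def
    proof (intro CollectI conjI ballI)
      show "\<kappa> z \<in> carrier K" using zc by simp
      fix k assume "k \<in> carrier K"
      then have "k \<in> \<kappa> ` M" using ontoM by (simp add: HM_def)
      then obtain m where m: "m \<in> M" "\<kappa> m = k" by blast
      have "\<kappa> (z \<otimes>\<^bsub>H\<^esub> m) = \<kappa> (m \<otimes>\<^bsub>H\<^esub> z)" by (simp only: comM[OF m(1)])
      then show "\<kappa> z \<otimes>\<^bsub>K\<^esub> k = k \<otimes>\<^bsub>K\<^esub> \<kappa> z" using zc m by (auto simp: M_iff)
    qed
    also note cen
    also have "derived K (carrier K) = \<kappa> ` derived HM (carrier HM)"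
      using group_hom.derived_img[OF \<kappa>M, of "carrier HM"] by (simp add: ontoM)
    \<comment> \<open>So \<open>z\<close> agrees with an element of \<open>[M, M]\<close> up to a factor \<open>\<zeta>\<close> in the kernel \<open>Z(H)\<close>.\<close>
    finally obtain c where c: "c \<in> derived HM (carrier HM)" "\<kappa> z = \<kappa> c" by blast
    have cM: "c \<in> M"
      using c(1) group.derived_in_carrier[OF HM, of "carrier HM"] by (auto simp: HM_def)
    have cc: "c \<in> carrier H" using cM Msub by blast
    define \<zeta> where "\<zeta> = inv\<^bsub>H\<^esub> c \<otimes>\<^bsub>H\<^esub> z"
    have \<zeta>: "\<zeta> \<in> group_center H"
      unfolding Z \<zeta>_def using zM cM zc cc c(2) by (simp add: M_iff)
    have \<zeta>c: "\<zeta> \<in> carrier H" using \<zeta> Z by blast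
    have z: "z = c \<otimes>\<^bsub>H\<^esub> \<zeta>"
      using zc cc by (simp add: \<zeta>_def H.m_assoc[symmetric])
    have "z \<otimes>\<^bsub>H\<^esub> g = g \<otimes>\<^bsub>H\<^esub> z" if g: "g \<in> carrier H" for g
    proof -
      \<comment> \<open>\<open>g\<close> splits as a product of an element of \<open>M\<close> and one that lies over \<open>V\<close>.\<close>
      obtain m where m: "m \<in> carrier H" "\<kappa> m = \<kappa> g" "\<nu> m = \<one>\<^bsub>V\<^esub>"
        using lift[OF \<kappa>.hom_closed[OF g] V.one_closed] by blast
      define n where "n = inv\<^bsub>H\<^esub> m \<otimes>\<^bsub>H\<^esub> g"
      have n: "n \<in> carrier H" "\<kappa> n = \<one>\<^bsub>K\<^esub>"
        unfolding n_def using m g by simp_all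
      have gmn: "g = m \<otimes>\<^bsub>H\<^esub> n" using m g by (simp add: n_def H.m_assoc[symmetric])
      have zm: "z \<otimes>\<^bsub>H\<^esub> m = m \<otimes>\<^bsub>H\<^esub> z" using m by (intro comM) (simp add: M_iff)
      have "z \<otimes>\<^bsub>H\<^esub> n = c \<otimes>\<^bsub>H\<^esub> (n \<otimes>\<^bsub>H\<^esub> \<zeta>)"
        using cc \<zeta>c n unfolding z by (simp add: H.m_assoc central[OF \<zeta>])
      also have "\<dots> = n \<otimes>\<^bsub>H\<^esub> z"
        using cc \<zeta>c n N_commutes[OF c(1) n] unfolding z by (simp add: H.m_assoc[symmetric])
      finally have zn: "z \<otimes>\<^bsub>H\<^esub> n = n \<otimes>\<^bsub>H\<^esub> z" .
      have "z \<otimes>\<^bsub>H\<^esub> g = m \<otimes>\<^bsub>H\<^esub> (z \<otimes>\<^bsub>H\<^esub> n)"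
        using zc m n by (simp add: gmn H.m_assoc[symmetric] zm)
      then show ?thesis using zc m n by (simp add: gmn zn H.m_assoc)
    qed
    then show "z \<in> group_center H" using zc by (simp add: group_center_def)
  next
    fix z assume "z \<in> group_center H"
    then show "z \<in> group_center HM"
      using Z[of z] central[of z] unfolding group_center_def[of HM] by (simp add: HM_def M_iff)
  qed
  then show ?thesis
    using capable_if_epi[OF HM K group_hom.homh[OF \<kappa>M] ontoM] kerM by simp
qed

section \<open>Adjoining a direct factor\<close>

text \<open>The semidirect product \<open>(V \<times> V) \<rtimes> H\<close> in which \<open>h\<close> acts by the unipotent map
  \<open>(v, t) \<mapsto> (v, t v\<^bsup>f(h)\<^esup>)\<close>. For \<open>H = V = C\<^sub>p\<close> and \<open>f\<close> the identity it is the Heisenberg group of order \<open>p\<^sup>3\<close>.\<close>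

definition shear_extension ::
    "('h, 'c) monoid_scheme \<Rightarrow> ('h \<Rightarrow> int) \<Rightarrow> ('v, 'd) monoid_scheme \<Rightarrow> ('h \<times> 'v \<times> 'v) monoid" where
  "shear_extension H f V =
     \<lparr>carrier = carrier H \<times> carrier V \<times> carrier V,
      monoid.mult = (\<lambda>(h, v, t) (h', v', t').
        (h \<otimes>\<^bsub>H\<^esub> h', v \<otimes>\<^bsub>V\<^esub> v', t \<otimes>\<^bsub>V\<^esub> (t' \<otimes>\<^bsub>V\<^esub> v' [^]\<^bsub>V\<^esub> f h))),
      one = (\<one>\<^bsub>H\<^esub>, \<one>\<^bsub>V\<^esub>, \<one>\<^bsub>V\<^esub>)\<rparr>"

locale shear = H: group H + V: comm_group V
  for H :: "('h, 'c) monoid_scheme" and V :: "('v, 'd) monoid_scheme" +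
  fixes f :: "'h \<Rightarrow> int" and n :: nat
  assumes f_hom: "f \<in> hom H (integer_mod_group n)"
    and f_onto: "\<exists>h\<in>carrier H. f h = 1"
    and exponent: "\<And>v. v \<in> carrier V \<Longrightarrow> v [^]\<^bsub>V\<^esub> n = \<one>\<^bsub>V\<^esub>"
begin

lemma pow_mod:
  assumes v: "v \<in> carrier V"
  shows "v [^]\<^bsub>V\<^esub> (i mod int n) = v [^]\<^bsub>V\<^esub> i"
proof -
  have "v [^]\<^bsub>V\<^esub> i = v [^]\<^bsub>V\<^esub> (int n * (i div int n) + i mod int n)" by simp
  also have "\<dots> = (v [^]\<^bsub>V\<^esub> int n) [^]\<^bsub>V\<^esub> (i div int n) \<otimes>\<^bsub>V\<^esub> v [^]\<^bsub>V\<^esub> (i mod int n)"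
    using v by (simp only: V.int_pow_mult V.int_pow_pow V.int_pow_closed)
  also have "\<dots> = v [^]\<^bsub>V\<^esub> (i mod int n)"
    using v exponent[OF v] by (simp add: int_pow_int V.int_pow_one)
  finally show ?thesis by simp
qed

lemma pow_f_mult:
  assumes "v \<in> carrier V" "h \<in> carrier H" "h' \<in> carrier H"
  shows "v [^]\<^bsub>V\<^esub> f (h \<otimes>\<^bsub>H\<^esub> h') = v [^]\<^bsub>V\<^esub> f h \<otimes>\<^bsub>V\<^esub> v [^]\<^bsub>V\<^esub> f h'"
  using assms hom_mult[OF f_hom assms(2,3)] by (simp add: pow_mod V.int_pow_mult)

lemma pow_f_one: "v [^]\<^bsub>V\<^esub> f \<one>\<^bsub>H\<^esub> = \<one>\<^bsub>V\<^esub>"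
  using hom_one[OF f_hom H.is_group group_integer_mod_group] by simp

abbreviation L where "L \<equiv> shear_extension H f V"

lemma group_shear_extension: "group L"
proof (rule groupI)
  show "x \<otimes>\<^bsub>L\<^esub> y \<in> carrier L" if "x \<in> carrier L" "y \<in> carrier L" for x y
    using that by (auto simp: shear_extension_def)
  show "\<one>\<^bsub>L\<^esub> \<in> carrier L" by (simp add: shear_extension_def)
  show "x \<otimes>\<^bsub>L\<^esub> y \<otimes>\<^bsub>L\<^esub> z = x \<otimes>\<^bsub>L\<^esub> (y \<otimes>\<^bsub>L\<^esub> z)"
    if "x \<in> carrier L" "y \<in> carrier L" "z \<in> carrier L" for x y z
    using that
    by (auto simp: shear_extension_def pow_f_mult H.m_assoc V.m_ac V.int_pow_distrib)
  show "\<one>\<^bsub>L\<^esub> \<otimes>\<^bsub>L\<^esub> x = x" if "x \<in> carrier L" for x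
    using that by (auto simp: shear_extension_def pow_f_one)
  show "\<exists>y\<in>carrier L. y \<otimes>\<^bsub>L\<^esub> x = \<one>\<^bsub>L\<^esub>" if x: "x \<in> carrier L" for x
  proof -
    obtain h v t where htv: "x = (h, v, t)" "h \<in> carrier H" "v \<in> carrier V" "t \<in> carrier V"
      using x by (auto simp: shear_extension_def)
    then show ?thesis
      by (intro bexI[of _ "(inv\<^bsub>H\<^esub> h, inv\<^bsub>V\<^esub> v, inv\<^bsub>V\<^esub> (t \<otimes>\<^bsub>V\<^esub> v [^]\<^bsub>V\<^esub> f (inv\<^bsub>H\<^esub> h)))"])
        (auto simp: shear_extension_def)
  qed
qed

text \<open>Commuting \<open>(h, v, t)\<close> with \<open>(k, w, 1)\<close> compares \<open>w\<^bsup>f(h)\<^esup>\<close> with \<open>v\<^bsup>f(k)\<^esup>\<close>. An element \<open>k\<close> with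
  \<open>f(k) = 1\<close> and \<open>w = 1\<close> then force \<open>v = 1\<close>, and what is left is \<open>w\<^bsup>f(h)\<^esup> = 1\<close>.\<close>

lemma center_shear_extension:
  "group_center L = {(h, v, t). h \<in> group_center H \<and> (\<forall>w\<in>carrier V. w [^]\<^bsub>V\<^esub> f h = \<one>\<^bsub>V\<^esub>)
      \<and> v = \<one>\<^bsub>V\<^esub> \<and> t \<in> carrier V}"
proof (intro equalityI subsetI)
  fix x assume x: "x \<in> group_center L"
  then obtain h v t where xe: "x = (h, v, t)"
    and c: "h \<in> carrier H" "v \<in> carrier V" "t \<in> carrier V"
    by (auto simp: group_center_def shear_extension_def)
  have com: "h \<otimes>\<^bsub>H\<^esub> k = k \<otimes>\<^bsub>H\<^esub> h \<and> w [^]\<^bsub>V\<^esub> f h = v [^]\<^bsub>V\<^esub> f k"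
    if k: "k \<in> carrier H" and w: "w \<in> carrier V" for k w
  proof -
    have "x \<otimes>\<^bsub>L\<^esub> (k, w, \<one>\<^bsub>V\<^esub>) = (k, w, \<one>\<^bsub>V\<^esub>) \<otimes>\<^bsub>L\<^esub> x"
      using x k w by (simp add: group_center_def) (simp add: shear_extension_def)
    then show ?thesis using c k w by (simp add: xe shear_extension_def)
  qed
  obtain k where k: "k \<in> carrier H" "f k = 1" using f_onto by blast
  have v: "v = \<one>\<^bsub>V\<^esub>"
    using com[OF k(1) V.one_closed] c by (simp add: k(2) V.int_pow_one V.int_pow_1)
  show "x \<in> {(h, v, t). h \<in> group_center H \<and> (\<forall>w\<in>carrier V. w [^]\<^bsub>V\<^esub> f h = \<one>\<^bsub>V\<^esub>)
      \<and> v = \<one>\<^bsub>V\<^esub> \<and> t \<in> carrier V}"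
    using com c k(1) by (auto simp: xe v group_center_def V.int_pow_one)
next
  fix x assume "x \<in> {(h, v, t). h \<in> group_center H \<and> (\<forall>w\<in>carrier V. w [^]\<^bsub>V\<^esub> f h = \<one>\<^bsub>V\<^esub>)
      \<and> v = \<one>\<^bsub>V\<^esub> \<and> t \<in> carrier V}"
  then show "x \<in> group_center L"
    by (auto simp: group_center_def shear_extension_def V.int_pow_one V.m_comm)
qed

text \<open>Forgetting \<open>t\<close> maps the shear extension onto \<open>K \<times> V\<close>. The hypothesis on the kernel of \<open>\<pi>\<close> says that
  \<open>\<pi>\<close> kills just those central elements of \<open>H\<close> that remain central in the extension.\<close>

lemma capable_times_if_kernel:
  assumes K: "group K" and \<pi>: "\<pi> \<in> hom H K" "\<pi> ` carrier H = carrier K"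
    and ker: "kernel H K \<pi> = {h \<in> group_center H. \<forall>w\<in>carrier V. w [^]\<^bsub>V\<^esub> f h = \<one>\<^bsub>V\<^esub>}"
  shows "capable (K \<times>\<times> V)"
proof (rule capable_if_epi[OF group_shear_extension DirProd_group[OF K V.is_group]])
  let ?\<rho> = "\<lambda>(h, v, t). (\<pi> h, v)"
  show "?\<rho> \<in> hom L (K \<times>\<times> V)"
    using \<pi>(1) by (auto simp: hom_def shear_extension_def)
  show "?\<rho> ` carrier L = carrier (K \<times>\<times> V)"
    unfolding shear_extension_def DirProd_def \<pi>(2)[symmetric] by (auto simp: image_iff)
  have "(h \<in> carrier H \<and> \<pi> h = \<one>\<^bsub>K\<^esub>) \<longleftrightarrow>
      h \<in> group_center H \<and> (\<forall>w\<in>carrier V. w [^]\<^bsub>V\<^esub> f h = \<one>\<^bsub>V\<^esub>)" for h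
    using ker by (auto simp: kernel_def set_eq_iff)
  then show "kernel L (K \<times>\<times> V) ?\<rho> = group_center L"
    unfolding center_shear_extension by (auto simp: kernel_def shear_extension_def)
qed

end

text \<open>Pulled back to a witness \<open>H\<close> of \<open>K\<close>, the homomorphism \<open>f\<close> vanishes on \<open>Z(H)\<close>, so all of \<open>Z(H)\<close> remains
  central in the shear extension.\<close>

lemma capable_times_if_hom_onto:
  fixes K :: "('k, 'c) monoid_scheme" and V :: "('v, 'd) monoid_scheme"
  assumes cap: "capable K" and K: "group K" and V: "comm_group V"
    and expo: "\<And>v. v \<in> carrier V \<Longrightarrow> v [^]\<^bsub>V\<^esub> n = \<one>\<^bsub>V\<^esub>"
    and f: "f \<in> hom K (integer_mod_group n)" "y \<in> carrier K" "f y = 1"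
  shows "capable (K \<times>\<times> V)"
proof -
  obtain H :: "(bool \<times> 'k) list monoid" and \<pi>
    where H: "group H" "\<pi> \<in> hom H K" "\<pi> ` carrier H = carrier K" "kernel H K \<pi> = group_center H"
    by (rule capable_epiE[OF cap K])
  interpret shear H V "f \<circ> \<pi>" n
  proof (intro shear.intro shear_axioms.intro H(1) V expo)
    show "f \<circ> \<pi> \<in> hom H (integer_mod_group n)" by (rule hom_compose[OF H(2) f(1)])
    obtain h where h: "h \<in> carrier H" "y = \<pi> h"
      using f(2) unfolding H(3)[symmetric] by blast
    show "\<exists>h\<in>carrier H. (f \<circ> \<pi>) h = 1" by (rule bexI[OF _ h(1)]) (use h(2) f(3) in simp)
  qed
  have "(f \<circ> \<pi>) h = 0" if "h \<in> group_center H" for h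
  proof -
    have "h \<in> kernel H K \<pi>" using that by (simp only: H(4))
    then show ?thesis using hom_one[OF f(1) K group_integer_mod_group] by (simp add: kernel_def)
  qed
  then have "kernel H K \<pi> = {h \<in> group_center H. \<forall>w\<in>carrier V. w [^]\<^bsub>V\<^esub> (f \<circ> \<pi>) h = \<one>\<^bsub>V\<^esub>}"
    unfolding H(4) by auto
  then show ?thesis by (rule capable_times_if_kernel[OF K H(2,3)])
qed

section \<open>Homomorphisms onto a cyclic group of prime order\<close>

text \<open>Choose a maximal proper subgroup \<open>M\<close> and \<open>y \<notin> M\<close>. By maximality every element is \<open>m y\<^sup>i\<close> with
  \<open>m \<in> M\<close>, and \<open>y\<^sup>i \<in> M\<close> only for multiples \<open>i\<close> of \<open>p\<close>, so \<open>i\<close> is well defined modulo \<open>p\<close>. Sending the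
  element to \<open>i\<close> is the required homomorphism.\<close>

lemma (in comm_group) exists_hom_onto_prime:
  assumes p: "Factorial_Ring.prime p" and fin: "finite (carrier G)" and nontriv: "carrier G \<noteq> {\<one>}"
    and expo: "\<And>x. x \<in> carrier G \<Longrightarrow> x [^] p = \<one>"
  obtains f y where "f \<in> hom G (integer_mod_group p)" "y \<in> carrier G" "f y = 1"
proof -
  let ?A = "{M. subgroup M G \<and> M \<noteq> carrier G}"
  have "?A \<subseteq> Pow (carrier G)" using subgroup.subset by blast
  then have "finite ?A" using fin by (meson finite_Pow_iff finite_subset)
  moreover have "{\<one>} \<in> ?A" using nontriv triv_subgroup by auto
  ultimately obtain M where M: "subgroup M G" "M \<noteq> carrier G"
    and max: "\<And>B. subgroup B G \<Longrightarrow> B \<noteq> carrier G \<Longrightarrow> M \<subseteq> B \<Longrightarrow> M = B"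
    using finite_has_maximal[of ?A] by blast
  interpret M: subgroup M G by (rule M)
  obtain y where y: "y \<in> carrier G" "y \<notin> M" using M M.subset by blast
  have y_p: "y [^] int p = \<one>" using expo[OF y(1)] by (simp add: int_pow_int)
  have powM: "y [^] i \<in> M \<longleftrightarrow> int p dvd i" for i :: int
  proof
    assume yi: "y [^] i \<in> M"
    show "int p dvd i"
    proof (rule ccontr)
      assume "\<not> int p dvd i"
      then have "coprime (int p) i" using p by (simp add: prime_imp_coprime)
      then obtain a b where ab: "a * int p + b * i = 1"
        using bezout_int[of "int p" i] by auto
      have "y = y [^] (int p * a + i * b)" using ab y(1) by (simp add: mult.commute int_pow_1)
      also have "\<dots> = (y [^] int p) [^] a \<otimes> (y [^] i) [^] b"
        using y(1) by (simp only: int_pow_mult int_pow_pow)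
      also have "\<dots> = (y [^] i) [^] b" using y(1) by (simp add: y_p)
      also have "\<dots> \<in> M" by (rule subgroup_int_pow_closed[OF M(1) yi])
      finally show False using y(2) by blast
    qed
  next
    assume "int p dvd i"
    then obtain k where "i = int p * k" by blast
    then have "y [^] i = (y [^] int p) [^] k" using y(1) by (simp only: int_pow_pow)
    then show "y [^] i \<in> M" by (simp add: y_p)
  qed
  \<comment> \<open>\<open>?q x i \<in> M\<close> expresses that \<open>x\<close> lies in the coset \<open>M y\<^sup>i\<close>.\<close>
  let ?q = "\<lambda>x (i::int). x \<otimes> inv (y [^] i)"
  have q_mult: "?q (x \<otimes> x') (i + j) = ?q x i \<otimes> ?q x' j"
    if "x \<in> carrier G" "x' \<in> carrier G" for x x' i j
    using that y(1) by (simp add: int_pow_mult inv_mult_group m_ac)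
  have cover: "\<exists>i. ?q x i \<in> M" if x: "x \<in> carrier G" for x
  proof -
    let ?B = "{x \<in> carrier G. \<exists>i. ?q x i \<in> M}"
    have "subgroup ?B G"
    proof (rule subgroupI)
      show "?B \<noteq> {}" by (auto intro!: exI[of _ \<one>] exI[of _ 0])
      fix a assume "a \<in> ?B"
      then obtain i where a: "a \<in> carrier G" "?q a i \<in> M" by blast
      have "inv (?q a i) = ?q (inv a) (- i)"
        using a y(1) by (simp add: inv_mult int_pow_neg)
      then show "inv a \<in> ?B" using a M.m_inv_closed[OF a(2)] by auto
      fix b assume "b \<in> ?B"
      then obtain j where b: "b \<in> carrier G" "?q b j \<in> M" by blast
      show "a \<otimes> b \<in> ?B"
        using a b M.m_closed[OF a(2) b(2)] unfolding q_mult[OF a(1) b(1), symmetric] by auto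
    qed auto
    moreover have "M \<subseteq> ?B"
      using M.subset by (auto intro!: exI[of _ 0])
    moreover have "y \<in> ?B"
      using y(1) by (auto intro!: exI[of _ 1])
    ultimately have "?B = carrier G" using max[of ?B] y(2) by blast
    then show ?thesis using x by blast
  qed
  define f where "f x = (SOME i. ?q x i \<in> M) mod int p" for x
  have f_eq: "f x = i mod int p" if x: "x \<in> carrier G" and i: "?q x i \<in> M" for x i
  proof -
    define e where "e = (SOME i. ?q x i \<in> M)"
    have e: "?q x e \<in> M" unfolding e_def using i by (rule someI)
    have "?q (x \<otimes> inv x) (i + - e) = ?q x i \<otimes> inv (?q x e)"
      using x y(1) by (subst q_mult) (simp_all add: inv_mult int_pow_neg)
    then have "inv (y [^] (i - e)) \<in> M"
      using M.m_closed[OF i M.m_inv_closed[OF e]] x y(1) by simp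
    then have "int p dvd i - e"
      using M.m_inv_closed powM y(1) by fastforce
    then show ?thesis unfolding f_def e_def[symmetric] by (simp add: mod_eq_dvd_iff dvd_diff_commute)
  qed
  have p1: "1 < int p" using prime_gt_1_nat[OF p] by simp
  show thesis
  proof (rule that[OF _ y(1)])
    show "f y = 1" using f_eq[of y 1] y(1) p1 by simp
    show "f \<in> hom G (integer_mod_group p)"
    proof (rule homI)
      show "f x \<in> carrier (integer_mod_group p)" for x
        using p1 by (simp add: f_def carrier_integer_mod_group)
      fix x x' assume x: "x \<in> carrier G" "x' \<in> carrier G"
      obtain i j where ij: "?q x i \<in> M" "?q x' j \<in> M" using cover x by blast
      have "?q (x \<otimes> x') (i + j) \<in> M"
        unfolding q_mult[OF x] using ij by (rule M.m_closed)
      then have "f (x \<otimes> x') = (i + j) mod int p" using x by (intro f_eq) auto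
      then show "f (x \<otimes> x') = f x \<otimes>\<^bsub>integer_mod_group p\<^esub> f x'"
        using f_eq[OF x(1) ij(1)] f_eq[OF x(2) ij(2)] by (simp add: mod_add_eq)
    qed
  qed
qed

lemma (in group) exists_hom_onto_prime_if_not_perfect:
  assumes p: "Factorial_Ring.prime p" and fin: "finite (carrier G)"
    and not_perfect: "derived G (carrier G) \<noteq> carrier G"
    and expo: "\<And>x. x \<in> carrier G \<Longrightarrow> x [^] p = \<one>"
  obtains f y where "f \<in> hom G (integer_mod_group p)" "y \<in> carrier G" "f y = 1"
proof -
  define D where "D = derived G (carrier G)"
  interpret D: normal D G unfolding D_def by (rule derived_is_normal[OF normal_self])
  define Q where "Q = G Mod D"
  interpret Q: comm_group Q unfolding Q_def D_def by (rule derived_quot_is_comm_group)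
  define q where "q = (\<lambda>x. D #> x)"
  have q: "q \<in> hom G Q" unfolding q_def Q_def by (rule D.r_coset_hom_Mod)
  have q_onto: "carrier Q = q ` carrier G" by (auto simp: Q_def q_def carrier_FactGroup)
  interpret q: group_hom G Q q using q by unfold_locales
  obtain x where x: "x \<in> carrier G" "x \<notin> D" using not_perfect D.subset unfolding D_def by blast
  have "q x \<noteq> \<one>\<^bsub>Q\<^esub>"
    using coset_join1[OF _ x(1) D.subgroup_axioms] x(2) by (auto simp: q_def Q_def one_FactGroup)
  then have "carrier Q \<noteq> {\<one>\<^bsub>Q\<^esub>}" using q.hom_closed[OF x(1)] by auto
  moreover have "finite (carrier Q)" using fin by (simp add: q_onto)
  moreover have "c [^]\<^bsub>Q\<^esub> p = \<one>\<^bsub>Q\<^esub>" if c: "c \<in> carrier Q" for c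
  proof -
    obtain x where "x \<in> carrier G" "c = q x" using c unfolding q_onto by (rule imageE)
    then show ?thesis using q.hom_nat_pow[of x p] expo by simp
  qed
  ultimately obtain f c where f: "f \<in> hom Q (integer_mod_group p)" "c \<in> carrier Q" "f c = 1"
    using Q.exists_hom_onto_prime[OF p] by blast
  obtain y where y: "y \<in> carrier G" "c = q y" using f(2) unfolding q_onto by (rule imageE)
  show thesis
    by (rule that[OF Group.hom_compose[OF q f(1)] y(1)]) (simp add: f(3) flip: y(2))
qed

section \<open>Elementary abelian groups\<close>

lemma component_hom:
  assumes "i \<in> I"
  shows "(\<lambda>x. x i) \<in> hom (product_group I G) (G i)"
  using assms by (auto simp: hom_def PiE_mem)

lemma comm_group_cyclic_power: "comm_group (cyclic_power p r)"
  unfolding cyclic_power_def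
  by (rule group.group_comm_groupI) (auto simp: add.commute)

lemma cyclic_power_exponent:
  assumes "x \<in> carrier (cyclic_power p r)"
  shows "x [^]\<^bsub>cyclic_power p r\<^esub> p = \<one>\<^bsub>cyclic_power p r\<^esub>"
proof (rule extensionalityI[of _ "{..<r}"])
  interpret comm_group "cyclic_power p r" by (rule comm_group_cyclic_power)
  show "x [^]\<^bsub>cyclic_power p r\<^esub> p \<in> extensional {..<r}"
    using nat_pow_closed[OF assms, of p] by (simp add: cyclic_power_def PiE_def)
  show "\<one>\<^bsub>cyclic_power p r\<^esub> \<in> extensional {..<r}"
    by (simp add: cyclic_power_def)
  fix i assume i: "i \<in> {..<r}"
  have "(x [^]\<^bsub>cyclic_power p r\<^esub> p) i = x i [^]\<^bsub>integer_mod_group p\<^esub> p"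
    using hom_nat_pow[OF component_hom[OF i, of "\<lambda>_. integer_mod_group p"], of x p] assms is_group
    by (simp add: cyclic_power_def)
  then show "(x [^]\<^bsub>cyclic_power p r\<^esub> p) i = \<one>\<^bsub>cyclic_power p r\<^esub> i"
    using i by (simp add: cyclic_power_def)
qed

lemma cyclic_power_Suc_iso:
  "cyclic_power p (Suc r) \<cong> integer_mod_group p \<times>\<times> cyclic_power p r"
proof -
  define h :: "(nat \<Rightarrow> int) \<Rightarrow> int \<times> (nat \<Rightarrow> int)" where "h x = (x r, restrict x {..<r})" for x
  define g :: "int \<times> (nat \<Rightarrow> int) \<Rightarrow> nat \<Rightarrow> int" where "g z = (snd z)(r := fst z)" for z
  have "h \<in> iso (cyclic_power p (Suc r)) (integer_mod_group p \<times>\<times> cyclic_power p r)"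
  proof (rule isoI)
    have h_closed: "h x \<in> carrier (integer_mod_group p \<times>\<times> cyclic_power p r)"
      if "x \<in> carrier (cyclic_power p (Suc r))" for x
      using that by (simp add: h_def cyclic_power_def PiE_iff)
    then show "h \<in> hom (cyclic_power p (Suc r)) (integer_mod_group p \<times>\<times> cyclic_power p r)"
      by (rule homI) (simp_all add: h_def cyclic_power_def restrict_def fun_eq_iff)
    have g_closed: "g z \<in> carrier (cyclic_power p (Suc r))"
      if "z \<in> carrier (integer_mod_group p \<times>\<times> cyclic_power p r)" for z
      using that by (cases z) (simp add: g_def cyclic_power_def lessThan_Suc PiE_fun_upd)
    show "bij_betw h (carrier (cyclic_power p (Suc r)))
        (carrier (integer_mod_group p \<times>\<times> cyclic_power p r))"
    proof (rule bij_betwI[of _ _ _ g])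
      fix x assume x: "x \<in> carrier (cyclic_power p (Suc r))"
      show "g (h x) = x"
      proof
        fix i
        have "x i = undefined" if "i \<notin> {..<Suc r}"
          using PiE_arb[OF _ that] x unfolding cyclic_power_def carrier_product_group by blast
        then show "g (h x) i = x i" by (auto simp: g_def h_def)
      qed
    next
      fix z assume z: "z \<in> carrier (integer_mod_group p \<times>\<times> cyclic_power p r)"
      then have "snd z \<in> extensional {..<r}" by (auto simp: cyclic_power_def PiE_def)
      then show "h (g z) = z"
        by (simp add: g_def h_def restrict_fupd extensional_restrict)
    qed (use h_closed g_closed in auto)
  qed
  then show ?thesis unfolding is_iso_def by blast
qed

lemma DirProd_trivial_iso:
  assumes "trivial_group B"
  shows "A \<times>\<times> B \<cong> A"
proof -
  have "fst \<in> iso (A \<times>\<times> B) A"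
    using assms by (intro isoI) (auto simp: hom_def DirProd_def trivial_group_def bij_betw_def inj_on_def)
  then show ?thesis unfolding is_iso_def by blast
qed

lemma cyclic_integer_mod_group: "cyclic_group (integer_mod_group n)"
proof (cases "n = 1")
  case True
  then show ?thesis using trivial_integer_mod_group trivial_imp_cyclic_group by blast
next
  case False
  have "carrier (integer_mod_group n) = range (\<lambda>i. i mod int n)"
  proof (intro equalityI subsetI)
    fix x assume "x \<in> carrier (integer_mod_group n)"
    then have "x = x mod int n" by (auto simp: carrier_integer_mod_group split: if_splits)
    then show "x \<in> range (\<lambda>i. i mod int n)" by (rule range_eqI)
  qed (auto simp: carrier_integer_mod_group)
  also have "\<dots> = range (\<lambda>i::int. 1 [^]\<^bsub>integer_mod_group n\<^esub> i)"
    by (rule arg_cong[of _ _ range], rule ext) (simp only: int_pow_integer_mod_group mult_1_right)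
  finally show ?thesis
    using False integer_mod_group_1 unfolding group.cyclic_group[OF group_integer_mod_group] by blast
qed

lemma cyclic_power_small_cyclic:
  assumes "r < 2"
  shows "cyclic_group (cyclic_power p r)"
proof -
  have 0: "trivial_group (cyclic_power p 0)"
    by (simp add: cyclic_power_def trivial_product_group)
  have "cyclic_power p (Suc 0) \<cong> integer_mod_group p"
    using cyclic_power_Suc_iso DirProd_trivial_iso[OF 0] by (rule iso_trans)
  then have "cyclic_group (cyclic_power p (Suc 0))"
    using isomorphic_group_cyclicity[OF _ comm_group.axioms(2)[OF comm_group_cyclic_power]
        group_integer_mod_group] cyclic_integer_mod_group by simp
  moreover have "r = 0 \<or> r = Suc 0" using assms by auto
  ultimately show ?thesis using trivial_imp_cyclic_group[OF 0] by blast
qed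

text \<open>Here \<open>C\<^sub>p\<close> takes the part of \<open>H\<close>, with the identity as both \<open>f\<close> and \<open>\<pi>\<close>, although \<open>C\<^sub>p\<close> itself is not
  capable: every nonzero \<open>h\<close> moves \<open>(v, 0)\<close> to \<open>(v, h v)\<close>, where \<open>v\<close> is the vector of ones in
  \<open>C\<^sub>p\<^bsup>r-1\<^esup>\<close>, nonzero since \<open>r \<ge> 2\<close>, so that nothing of \<open>C\<^sub>p\<close> remains in the center.\<close>

lemma capable_cyclic_power:
  assumes "1 < p" "2 \<le> r"
  shows "capable (cyclic_power p r)"
proof -
  let ?C = "integer_mod_group p" and ?V = "cyclic_power p (r - 1)"
  interpret V: comm_group ?V by (rule comm_group_cyclic_power)
  have Suc_r: "Suc (r - 1) = r" using assms(2) by simp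
  interpret V': comm_group "cyclic_power p r" by (rule comm_group_cyclic_power)
  have CV: "group (?C \<times>\<times> ?V)" by (rule DirProd_group[OF group_integer_mod_group V.is_group])
  interpret shear ?C ?V "\<lambda>h. h" p
  proof (intro shear.intro shear_axioms.intro group_integer_mod_group comm_group_cyclic_power
      cyclic_power_exponent)
    show "(\<lambda>h. h) \<in> hom ?C ?C"
      using monoid.m_closed[OF group.is_monoid[OF group_integer_mod_group]] by (intro homI) auto
    show "\<exists>h\<in>carrier ?C. h = 1" using assms(1) by simp
  qed
  have "h = 0" if h: "h \<in> carrier ?C" and triv: "\<And>w. w \<in> carrier ?V \<Longrightarrow> w [^]\<^bsub>?V\<^esub> h = \<one>\<^bsub>?V\<^esub>" for h
  proof -
    have 0: "0 \<in> {..<r - 1}" using assms(2) by auto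
    let ?w = "\<lambda>i\<in>{..<r - 1}. 1 :: int"
    have w: "?w \<in> carrier ?V" using assms(1) by (auto simp: cyclic_power_def)
    have "(?w [^]\<^bsub>?V\<^esub> h) 0 = ?w 0 [^]\<^bsub>?C\<^esub> h"
      using hom_int_pow[OF component_hom[OF 0, of "\<lambda>_. ?C"], of ?w h] w V.is_group
      by (simp add: cyclic_power_def)
    then have "h mod int p = 0"
      using triv[OF w] 0 by (simp add: int_pow_integer_mod_group cyclic_power_def)
    then show ?thesis using h assms(1) by (simp add: carrier_integer_mod_group)
  qed
  then have "kernel ?C ?C (\<lambda>h. h)
      = {h \<in> group_center ?C. \<forall>w\<in>carrier ?V. w [^]\<^bsub>?V\<^esub> h = \<one>\<^bsub>?V\<^esub>}"
    by (auto simp: kernel_def group_center_def add.commute)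
  then have "capable (?C \<times>\<times> ?V)"
    by (intro capable_times_if_kernel) (auto simp: hom_def)
  then show ?thesis
    using V'.is_group
    by (rule capable_iso[OF _ CV])
      (rule group.iso_sym[OF V'.is_group cyclic_power_Suc_iso[of p "r - 1", unfolded Suc_r]])
qed

theorem theorem4p17:
  fixes G :: "'a monoid" and K :: "'k monoid" and p r :: nat
  assumes "Factorial_Ring.prime p" "odd p"
    and "group G" "finite (carrier G)" "\<not> cyclic_group G"
    and "nilpotent_class_le G 2" "group_exponent G = p"
    and "group K" "G \<cong> K \<times>\<times> cyclic_power p r"
    and "group_center K = derived K (carrier K)"
  shows "capable G \<longleftrightarrow> capable K"
proof -
  let ?V = "cyclic_power p r"
  interpret G: group G by (rule assms)
  interpret K: group K by (rule assms)
  interpret V: comm_group ?V by (rule comm_group_cyclic_power)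
  have KV: "group (K \<times>\<times> ?V)" by (rule DirProd_group[OF K.is_group V.is_group])
  have "capable G \<longleftrightarrow> capable (K \<times>\<times> ?V)"
    using capable_iso[OF _ assms(3) KV assms(9)]
      capable_iso[OF _ KV assms(3) G.iso_sym[OF assms(9)]] by blast
  moreover have "capable K" if "capable (K \<times>\<times> ?V)"
    using capable_direct_factor[OF assms(8) V.is_group that] assms(10) by simp
  moreover have "capable (K \<times>\<times> ?V)" if cap: "capable K"
  proof (cases "carrier K = {\<one>\<^bsub>K\<^esub>}")
    case True
    then have "trivial_group K" by (simp add: trivial_group_def)
    then have iso: "K \<times>\<times> ?V \<cong> ?V"
      by (rule iso_trans[OF DirProd_commute_iso DirProd_trivial_iso])
    then have "\<not> cyclic_group ?V"
      using assms(5) isomorphic_group_cyclicity[OF iso_trans[OF assms(9) iso] assms(3) V.is_group] by blast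
    then have "2 \<le> r" using cyclic_power_small_cyclic by (meson not_less)
    then have "capable ?V"
      using capable_cyclic_power prime_gt_1_nat[OF assms(1)] by blast
    then show ?thesis
      using capable_iso[OF _ V.is_group KV group.iso_sym[OF KV iso]] by blast
  next
    case False
    obtain \<phi> where \<phi>: "\<phi> \<in> iso G (K \<times>\<times> ?V)" using assms(9) unfolding is_iso_def by blast
    define \<theta> where "\<theta> = fst \<circ> \<phi>"
    have "fst \<in> hom (K \<times>\<times> ?V) K" by (auto simp: hom_def)
    then have \<theta>: "\<theta> \<in> hom G K"
      using \<phi> unfolding \<theta>_def by (auto simp: iso_def intro: hom_compose)
    have \<theta>_onto: "\<theta> ` carrier G = carrier K"
      unfolding \<theta>_def image_comp[symmetric] using \<phi> V.one_closed
      by (auto simp: iso_def bij_betw_def)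
    interpret \<theta>: group_hom G K \<theta> using \<theta> by unfold_locales
    have finK: "finite (carrier K)" unfolding \<theta>_onto[symmetric] using assms(4) by (rule finite_imageI)
    have "\<exists>n::nat. 0 < n \<and> (\<forall>x\<in>carrier G. x [^]\<^bsub>G\<^esub> n = \<one>\<^bsub>G\<^esub>)"
      by (rule exI[of _ "order G"]) (simp add: G.pow_order_eq_1 G.order_gt_0_iff_finite assms(4))
    from LeastI_ex[OF this] have expG: "x [^]\<^bsub>G\<^esub> p = \<one>\<^bsub>G\<^esub>" if "x \<in> carrier G" for x
      using that assms(7) unfolding group_exponent_def by blast
    have expK: "x [^]\<^bsub>K\<^esub> p = \<one>\<^bsub>K\<^esub>" if x: "x \<in> carrier K" for x
    proof -
      obtain g where "g \<in> carrier G" "x = \<theta> g" using x unfolding \<theta>_onto[symmetric] by (rule imageE)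
      then show ?thesis using \<theta>.hom_nat_pow[of g p] expG by simp
    qed
    \<comment> \<open>A perfect \<open>K\<close> would equal its own center, and so be abelian and perfect, hence trivial.\<close>
    have "derived K (carrier K) \<noteq> carrier K"
    proof
      assume perfect: "derived K (carrier K) = carrier K"
      have "comm_group K"
      proof (rule K.group_comm_groupI)
        fix x y assume "x \<in> carrier K" "y \<in> carrier K"
        then have "x \<in> group_center K" using assms(10) perfect by simp
        then show "x \<otimes>\<^bsub>K\<^esub> y = y \<otimes>\<^bsub>K\<^esub> x" using \<open>y \<in> carrier K\<close> by (simp add: group_center_def)
      qed
      then show False using comm_group.derived_eq_singleton[of K "carrier K"] perfect False by simp
    qed
    then obtain f y where "f \<in> hom K (integer_mod_group p)" "y \<in> carrier K" "f y = 1"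
      using K.exists_hom_onto_prime_if_not_perfect[OF assms(1) finK _ expK] by blast
    then show ?thesis
      using capable_times_if_hom_onto[OF cap K.is_group V.comm_group_axioms cyclic_power_exponent] by blast
  qed
  ultimately show ?thesis by blast
qed

end
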